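(* Let $X$ be an infinite set, let $P$ be an infinite sublattice of $2^{\mathcal{P}(X)}$ and let $x \in 2^{\mathcal{P}(X)}$. Then: (i) If $x$ is a limit point of $P$ in the space $2^{\mathcal{P}(X)}$, then $x$ can be expressed in the form $x = \bigwedge_{j \in J} \bigvee_{i \in I_j} x_{i,j}$, where $x \neq x_{i,j}$ for all $i,j$, and for each $j \in J$ the set $\{x_{i,j} \mid i \in I_j\}$ is an infinite subset of $P$. (ii) $\overline{P} = \hat{P}$; that is, the topological closure of $P$ in $2^{\mathcal{P}(X)}$ coincides with its lattice-theoretic completion.
   Context: $2^{\mathcal{P}(X)}$ is identified with $\mathcal{P}(\mathcal{P}(X))$, the set of all families of subsets of $X$. It is a complete Boolean lattice under inclusion $\subseteq$ (so $\bigvee$ and $\bigwedge$ are union and intersection of families), and it carries the product topology, where $2=\{0,1\}$ is discrete. Thus a subbase of open sets is given by $A^+ = \{x : A \in x\}$ and $A^- = \{x : A \notin x\}$ for $A \in \mathcal{P}(X)$. A sublattice is a nonempty subset closed under binary joins (unions) and meets (intersections). A sublattice $L$ of $2^{\mathcal{P}(X)}$ is complete if it contains $\bigcup S$ and $\bigcap S$ for every nonempty $S \subseteq L$. The completion of a sublattice $P$ is $\hat P = \bigcap\{L : P \subseteq L,\ L \text{ a complete sublattice of } 2^{\mathcal{P}(X)}\}$. $\overline{P}$ is the closure of $P$ in $2^{\mathcal{P}(X)}$. A limit point of $P$ is a point $x$ each of whose neighbourhoods contains a point of $P$ other than $x$. *)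

theory Defs
  imports "HOL-Analysis.Analysis"
begin

text \<open>
  For a set \<open>X\<close>, the points of \<open>2\<^sup>P\<^sup>(\<^sup>X\<^sup>)\<close> are the families of subsets of \<open>X\<close>, that is, the
  elements of \<open>Pow (Pow X)\<close>.
\<close>

definition char_map :: "'a set \<Rightarrow> 'a set set \<Rightarrow> ('a set \<Rightarrow> bool)"
  where "char_map X x = restrict (\<lambda>A. A \<in> x) (Pow X)"

text \<open>
  The map \<open>char_map X\<close> identifies \<open>Pow (Pow X)\<close> with the underlying set of the product space (see
  \<open>bij_betw_char_map\<close> below), so the pullback is the product topology transported along this
  identification. The discrete two-point space is \<open>bool\<close>.
\<close>

definition family_topology :: "'a set \<Rightarrow> 'a set set topology"
  where "family_topology X =
    pullback_topology (Pow (Pow X)) (char_map X)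
      (product_topology (\<lambda>_. discrete_topology (UNIV :: bool set)) (Pow X))"

definition sublattice :: "'a set \<Rightarrow> 'a set set set \<Rightarrow> bool"
  where "sublattice X L \<longleftrightarrow>
    L \<subseteq> Pow (Pow X) \<and> L \<noteq> {} \<and> (\<forall>x\<in>L. \<forall>y\<in>L. x \<union> y \<in> L \<and> x \<inter> y \<in> L)"

definition complete_sublattice :: "'a set \<Rightarrow> 'a set set set \<Rightarrow> bool"
  where "complete_sublattice X L \<longleftrightarrow>
    sublattice X L \<and> (\<forall>S. S \<subseteq> L \<and> S \<noteq> {} \<longrightarrow> \<Union>S \<in> L \<and> \<Inter>S \<in> L)"

definition lattice_completion :: "'a set \<Rightarrow> 'a set set set \<Rightarrow> 'a set set set"
  where "lattice_completion X P = \<Inter>{L. P \<subseteq> L \<and> complete_sublattice X L}"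

lemma char_map_apply: "A \<in> Pow X \<Longrightarrow> char_map X x A \<longleftrightarrow> A \<in> x"
  by (simp add: char_map_def)

lemma char_map_in_topspace:
  "char_map X x \<in> topspace (product_topology (\<lambda>_. discrete_topology (UNIV :: bool set)) (Pow X))"
  by (simp add: char_map_def)

lemma bij_betw_char_map:
  "bij_betw (char_map X) (Pow (Pow X))
    (topspace (product_topology (\<lambda>_. discrete_topology (UNIV :: bool set)) (Pow X)))"
proof (rule bij_betw_byWitness[where f' = "\<lambda>f. {A \<in> Pow X. f A}"])
  show "\<forall>x\<in>Pow (Pow X). {A \<in> Pow X. char_map X x A} = x"
    by (auto simp: char_map_apply)
  show "\<forall>f\<in>topspace (product_topology (\<lambda>_. discrete_topology (UNIV :: bool set)) (Pow X)).
      char_map X {A \<in> Pow X. f A} = f"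
  proof
    fix f :: "'a set \<Rightarrow> bool"
    assume "f \<in> topspace (product_topology (\<lambda>_. discrete_topology UNIV) (Pow X))"
    then have "f \<in> extensional (Pow X)"
      by (simp add: PiE_iff)
    then show "char_map X {A \<in> Pow X. f A} = f"
      by (intro extensionalityI[of _ "Pow X"]) (simp_all add: char_map_def)
  qed
  show "char_map X ` Pow (Pow X) \<subseteq>
      topspace (product_topology (\<lambda>_. discrete_topology (UNIV :: bool set)) (Pow X))"
    using char_map_in_topspace by blast
qed auto

lemma topspace_family_topology [simp]: "topspace (family_topology X) = Pow (Pow X)"
  unfolding family_topology_def topspace_pullback_topology
  by (simp only: set_eq_iff Int_iff vimage_eq char_map_in_topspace simp_thms)

lemma family_topology_subbase:
  "family_topology X = topology_generated_by
    ((\<lambda>A. {x \<in> Pow (Pow X). A \<in> x}) ` Pow X \<union> (\<lambda>A. {x \<in> Pow (Pow X). A \<notin> x}) ` Pow X)"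
  (is "_ = topology_generated_by ?B")
proof -
  let ?D = "discrete_topology (UNIV :: bool set)"
  let ?T = "product_topology (\<lambda>_. ?D) (Pow X)"
  let ?G = "topology_generated_by ?B"
  have topG: "topspace ?G = Pow (Pow X)"
    by auto
  have coord: "openin (family_topology X) {x \<in> Pow (Pow X). (A \<in> x) \<in> U}"
    if "A \<in> Pow X" for A and U :: "bool set"
  proof -
    have "openin ?T {f \<in> topspace ?T. f A \<in> U}"
      by (rule openin_continuous_map_preimage[OF continuous_map_product_projection])
        (use that in auto)
    moreover have "char_map X -` {f \<in> topspace ?T. f A \<in> U} \<inter> Pow (Pow X)
        = {x \<in> Pow (Pow X). (A \<in> x) \<in> U}"
      by (simp only: set_eq_iff Int_iff vimage_eq mem_Collect_eq char_map_in_topspace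
          char_map_apply[OF that] simp_thms conj_commute)
    ultimately show ?thesis
      unfolding family_topology_def openin_pullback_topology
      by (intro exI[of _ "{f \<in> topspace ?T. f A \<in> U}"] conjI) (simp_all only:)
  qed
  have base: "openin (family_topology X) S" if "S \<in> ?B" for S
    using that coord[where U = "{True}"] coord[where U = "{False}"] by auto
  have le: "openin (family_topology X) S" if "openin ?G S" for S
    using openin_topology_generated_by[OF that]
  proof (induction rule: generate_topology_on.induct)
    case (Basis s)
    then show ?case by (rule base)
  qed (simp_all add: openin_Union openin_Int)
  have "continuous_map ?G ?T (char_map X)"
    unfolding continuous_map_componentwise
  proof (intro conjI ballI)
    show "char_map X ` topspace ?G \<subseteq> extensional (Pow X)"
      by (simp add: char_map_def image_subset_iff)
    fix A assume A: "A \<in> Pow X"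
    have pm: "openin ?G {x \<in> Pow (Pow X). A \<in> x}" "openin ?G {x \<in> Pow (Pow X). A \<notin> x}"
      using A by (auto intro!: topology_generated_by_Basis)
    have "openin ?G {x \<in> topspace ?G. char_map X x A \<in> U}" for U :: "bool set"
    proof -
      have "{x \<in> topspace ?G. char_map X x A \<in> U} =
          (if True \<in> U then {x \<in> Pow (Pow X). A \<in> x} else {}) \<union>
          (if False \<in> U then {x \<in> Pow (Pow X). A \<notin> x} else {})"
      proof (intro set_eqI)
        fix x
        show "x \<in> {x \<in> topspace ?G. char_map X x A \<in> U} \<longleftrightarrow>
            x \<in> (if True \<in> U then {x \<in> Pow (Pow X). A \<in> x} else {}) \<union>
              (if False \<in> U then {x \<in> Pow (Pow X). A \<notin> x} else {})"
          unfolding topG by (cases "A \<in> x") (simp_all add: char_map_apply[OF A])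
      qed
      then show ?thesis
        using pm by auto
    qed
    then show "continuous_map ?G ?D (\<lambda>x. char_map X x A)"
      by (simp add: continuous_map_def)
  qed
  then have ge: "openin ?G S" if "openin (family_topology X) S" for S
  proof -
    obtain U where U: "openin ?T U" "S = char_map X -` U \<inter> Pow (Pow X)"
      using \<open>openin (family_topology X) S\<close>
      unfolding family_topology_def openin_pullback_topology by blast
    have "S = {x \<in> topspace ?G. char_map X x \<in> U}"
      unfolding U(2) topG by auto
    with openin_continuous_map_preimage[OF \<open>continuous_map ?G ?T (char_map X)\<close> U(1)]
    show ?thesis by simp
  qed
  show ?thesis
    unfolding topology_eq using le ge by (intro allI iffI)
qed

end

theory Submission
  imports Defs
begin

text \<open>
  A basic neighbourhood of a family \<open>x\<close> consists of the families with the same trace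
  \<open>x \<inter> F\<close> on some finite \<open>F\<close>, so \<open>x\<close> lies in the closure of \<open>Q\<close> exactly when every finite trace
  of \<open>x\<close> is the trace of a member of \<open>Q\<close> (\<open>in_closure_of_family_iff\<close>). Everything else is read
  off from this description.

  Traces on two-point sets already express a point of the closure by members of \<open>Q\<close>. If
  \<open>A \<notin> x\<close>, then for each \<open>B \<in> x\<close> some \<open>y \<in> Q\<close> contains \<open>B\<close> and omits \<open>A\<close>; hence the union of all
  members of \<open>Q\<close> that omit \<open>A\<close> covers \<open>x\<close> and still omits \<open>A\<close>, and intersecting these unions over
  all \<open>A \<notin> x\<close> leaves exactly \<open>x\<close> (\<open>closure_point_eq_Inter_Union\<close>). For a limit point of \<open>P\<close>,
  take \<open>Q = P - {x}\<close>; each of the unions then has infinitely many terms, because the space is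
  Hausdorff and so the neighbourhood \<open>{y. A \<notin> y}\<close> of \<open>x\<close> meets \<open>P\<close> in an infinite set.

  The same formula with \<open>Q = P\<close> puts the closure of \<open>P\<close> inside every complete sublattice
  containing \<open>P\<close>. Conversely, the closure is itself a complete sublattice
  (\<open>complete_sublattice_closure_of\<close>): modulo a finite \<open>F\<close>, the join of arbitrarily many families
  is a join of finitely many traces, and the traces of the members of \<open>P\<close> on \<open>F\<close> are closed under
  finite joins because \<open>P\<close> is; likewise for meets.
\<close>

section \<open>Neighbourhoods given by finite traces\<close>

definition trace_nhd :: "'a set \<Rightarrow> 'a set set \<Rightarrow> 'a set set \<Rightarrow> 'a set set set"
  where "trace_nhd X x F = {y \<in> Pow (Pow X). y \<inter> F = x \<inter> F}"

lemma openin_trace_nhd: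
  assumes "x \<in> Pow (Pow X)" and "finite F"
  shows "openin (family_topology X) (trace_nhd X x F)"
  using assms(2)
proof (induction F)
  case empty
  have "trace_nhd X x {} = topspace (family_topology X)"
    by (auto simp: trace_nhd_def)
  then show ?case
    by (simp only: openin_topspace)
next
  case (insert A F)
  have "openin (family_topology X) (trace_nhd X x {A})"
  proof (cases "A \<in> Pow X")
    case True
    have "trace_nhd X x {A} =
        (if A \<in> x then {y \<in> Pow (Pow X). A \<in> y} else {y \<in> Pow (Pow X). A \<notin> y})"
      by (auto simp: trace_nhd_def)
    then show ?thesis
      unfolding family_topology_subbase using True
      by (auto intro!: topology_generated_by_Basis)
  next
    \<comment> \<open>No family of subsets of \<open>X\<close> contains such an \<open>A\<close>, so the trace imposes no condition.\<close>
    case False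
    then have "trace_nhd X x {A} = topspace (family_topology X)"
      using assms(1) by (auto simp: trace_nhd_def)
    then show ?thesis
      by (simp only: openin_topspace)
  qed
  moreover have "trace_nhd X x (insert A F) = trace_nhd X x {A} \<inter> trace_nhd X x F"
    unfolding trace_nhd_def by blast
  ultimately show ?case
    using insert.IH by (simp add: openin_Int)
qed

lemma open_contains_trace_nhd:
  assumes "openin (family_topology X) U" and "x \<in> U"
  obtains F where "finite F" and "trace_nhd X x F \<subseteq> U"
proof -
  have "\<exists>F. finite F \<and> trace_nhd X x F \<subseteq> U"
    using openin_topology_generated_by[OF assms(1)[unfolded family_topology_subbase]] assms(2)
  proof (induction rule: generate_topology_on.induct)
    case (Int U V)
    then obtain F G where "finite F" "trace_nhd X x F \<subseteq> U" "finite G" "trace_nhd X x G \<subseteq> V"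
      by blast
    moreover have "trace_nhd X x (F \<union> G) \<subseteq> trace_nhd X x F \<inter> trace_nhd X x G"
      unfolding trace_nhd_def by blast
    ultimately show ?case
      by (intro exI[of _ "F \<union> G"]) blast
  next
    case (UN K)
    then obtain k F where "k \<in> K" "finite F" "trace_nhd X x F \<subseteq> k"
      by blast
    then show ?case
      by (meson Union_upper order_trans)
  next
    case (Basis U)
    then have "\<exists>A. U = {y \<in> Pow (Pow X). A \<in> y} \<or> U = {y \<in> Pow (Pow X). A \<notin> y}"
      by (elim UnE imageE) metis+
    then obtain A where "U = {y \<in> Pow (Pow X). A \<in> y} \<or> U = {y \<in> Pow (Pow X). A \<notin> y}" ..
    then have "trace_nhd X x {A} \<subseteq> U"
      using Basis.prems by (auto simp: trace_nhd_def)
    then show ?case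
      by blast
  qed simp
  then show thesis
    using that by blast
qed

lemma in_closure_of_family_iff:
  assumes "Q \<subseteq> Pow (Pow X)"
  shows "x \<in> family_topology X closure_of Q \<longleftrightarrow>
    x \<in> Pow (Pow X) \<and> (\<forall>F. finite F \<longrightarrow> (\<exists>y\<in>Q. y \<inter> F = x \<inter> F))"
proof
  assume x: "x \<in> family_topology X closure_of Q"
  then have xX: "x \<in> Pow (Pow X)"
    using closure_of_subset_topspace by fastforce
  have "\<exists>y\<in>Q. y \<inter> F = x \<inter> F" if F: "finite F" for F
  proof -
    have "x \<in> trace_nhd X x F"
      using xX by (simp add: trace_nhd_def)
    then obtain y where "y \<in> Q" "y \<in> trace_nhd X x F"
      using x openin_trace_nhd[OF xX F] by (auto simp: in_closure_of)
    then show ?thesis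
      by (auto simp: trace_nhd_def)
  qed
  then show "x \<in> Pow (Pow X) \<and> (\<forall>F. finite F \<longrightarrow> (\<exists>y\<in>Q. y \<inter> F = x \<inter> F))"
    using xX by blast
next
  assume x: "x \<in> Pow (Pow X) \<and> (\<forall>F. finite F \<longrightarrow> (\<exists>y\<in>Q. y \<inter> F = x \<inter> F))"
  have "\<exists>y. y \<in> Q \<and> y \<in> U" if U: "x \<in> U" "openin (family_topology X) U" for U
  proof -
    obtain F where F: "finite F" "trace_nhd X x F \<subseteq> U"
      using open_contains_trace_nhd[OF U(2,1)] .
    then obtain y where "y \<in> Q" "y \<inter> F = x \<inter> F"
      using x by blast
    moreover from this have "y \<in> trace_nhd X x F"
      using assms by (simp add: trace_nhd_def subset_iff)
    ultimately show ?thesis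
      using F(2) by blast
  qed
  then show "x \<in> family_topology X closure_of Q"
    using x by (simp add: in_closure_of)
qed

lemma Hausdorff_space_family_topology: "Hausdorff_space (family_topology X)"
  unfolding Hausdorff_space_def
proof (intro allI impI, elim conjE)
  fix x y :: "'a set set"
  assume xy: "x \<in> topspace (family_topology X)" "y \<in> topspace (family_topology X)" "x \<noteq> y"
  then obtain A where A: "A \<in> x \<longleftrightarrow> A \<notin> y"
    by blast
  have "openin (family_topology X) (trace_nhd X x {A})" "openin (family_topology X) (trace_nhd X y {A})"
    using xy by (simp_all add: openin_trace_nhd)
  moreover have "x \<in> trace_nhd X x {A}" "y \<in> trace_nhd X y {A}"
    using xy by (simp_all add: trace_nhd_def)
  moreover have "disjnt (trace_nhd X x {A}) (trace_nhd X y {A})"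
    using A by (auto simp: trace_nhd_def disjnt_def)
  ultimately show "\<exists>U V. openin (family_topology X) U \<and> openin (family_topology X) V \<and>
      x \<in> U \<and> y \<in> V \<and> disjnt U V"
    by blast
qed

section \<open>Points of the closure as meets of joins\<close>

text \<open>
  The term \<open>\<Union>Q\<close> of the intersection removes the \<open>A\<close> that are not subsets of \<open>X\<close>. It also keeps
  the intersection from being indexed by the empty set when \<open>x = Pow X\<close>.
\<close>

lemma closure_point_eq_Inter_Union:
  assumes Q: "Q \<subseteq> Pow (Pow X)" and x: "x \<in> family_topology X closure_of Q"
  shows "x = (\<Inter>S \<in> insert Q ((\<lambda>A. {y \<in> Q. A \<notin> y}) ` (Pow X - x)). \<Union>S)"
proof (intro equalityI subsetI)
  fix B assume B: "B \<in> x"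
  have sep: "\<exists>y\<in>Q. B \<in> y \<and> A \<notin> y" if "A \<notin> x" for A
  proof -
    have "\<exists>y\<in>Q. y \<inter> {A, B} = x \<inter> {A, B}"
      using x by (simp add: in_closure_of_family_iff[OF Q])
    then show ?thesis
      using B that by blast
  qed
  have "\<exists>y\<in>Q. y \<inter> {B} = x \<inter> {B}"
    using x by (simp add: in_closure_of_family_iff[OF Q])
  then have "B \<in> \<Union>Q"
    using B by blast
  then show "B \<in> (\<Inter>S \<in> insert Q ((\<lambda>A. {y \<in> Q. A \<notin> y}) ` (Pow X - x)). \<Union>S)"
    using sep by blast
next
  fix A assume A: "A \<in> (\<Inter>S \<in> insert Q ((\<lambda>A. {y \<in> Q. A \<notin> y}) ` (Pow X - x)). \<Union>S)"
  then have "A \<in> \<Union>Q" and un: "\<And>B. B \<in> Pow X - x \<Longrightarrow> A \<in> \<Union>{y \<in> Q. B \<notin> y}"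
    by simp_all
  then obtain y where "y \<in> Q" "A \<in> y"
    by blast
  then have "A \<in> Pow X"
    using Q by (meson PowD subsetD)
  show "A \<in> x"
  proof (rule ccontr)
    assume "A \<notin> x"
    then have "A \<in> \<Union>{y \<in> Q. A \<notin> y}"
      using \<open>A \<in> Pow X\<close> by (intro un) (rule DiffI)
    then show False
      by simp
  qed
qed

lemma infinite_members_avoiding:
  assumes x: "x \<in> family_topology X derived_set_of P" and A: "A \<notin> x"
  shows "infinite {y \<in> P - {x}. A \<notin> y}"
proof -
  have xX: "x \<in> Pow (Pow X)"
    using x derived_set_of_subset_topspace by fastforce
  then have "x \<in> trace_nhd X x {A}"
    by (simp add: trace_nhd_def)
  then have "infinite (P \<inter> trace_nhd X x {A})"
    using x openin_trace_nhd[OF xX, of "{A}"]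
    by (auto simp: derived_set_of_infinite_openin[OF Hausdorff_space_family_topology])
  then have "infinite (P \<inter> trace_nhd X x {A} - {x})"
    by simp
  moreover have "P \<inter> trace_nhd X x {A} - {x} \<subseteq> {y \<in> P - {x}. A \<notin> y}"
    using A by (auto simp: trace_nhd_def)
  ultimately show ?thesis
    using finite_subset by blast
qed

lemma limit_point_eq_Inter_Union:
  assumes P: "P \<subseteq> Pow (Pow X)" "infinite P" and x: "x \<in> family_topology X derived_set_of P"
  obtains J where "J \<noteq> {}" "x = (\<Inter>S\<in>J. \<Union>S)" "\<And>S. S \<in> J \<Longrightarrow> infinite S \<and> S \<subseteq> P - {x}"
proof
  let ?J = "insert (P - {x}) ((\<lambda>A. {y \<in> P - {x}. A \<notin> y}) ` (Pow X - x))"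
  have "x \<in> family_topology X closure_of (P - {x})"
    using x unfolding in_derived_set_of in_closure_of by blast
  then show "x = (\<Inter>S\<in>?J. \<Union>S)"
    using P(1) by (intro closure_point_eq_Inter_Union) auto
  show "infinite S \<and> S \<subseteq> P - {x}" if "S \<in> ?J" for S
    using that P(2) infinite_members_avoiding[OF x] by auto
  show "?J \<noteq> {}"
    by simp
qed

section \<open>The closure as the lattice completion\<close>

lemma Union_Inter_mem_if_finite:
  assumes "finite S" "S \<noteq> {}" "S \<subseteq> L"
    and "\<And>x y. x \<in> L \<Longrightarrow> y \<in> L \<Longrightarrow> x \<union> y \<in> L \<and> x \<inter> y \<in> L"
  shows "\<Union>S \<in> L \<and> \<Inter>S \<in> L"
  using assms(1-3)
proof (induction rule: finite_ne_induct)
  case (insert x S)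
  then show ?case
    using assms(4)[of x "\<Union>S"] assms(4)[of x "\<Inter>S"] by simp
qed simp

text \<open>
  The point is that \<open>?T ` S\<close> below is finite for an arbitrary set \<open>S\<close> of families, since there are
  only finitely many traces on a finite set. This turns closure of \<open>P\<close> under binary operations
  into completeness of its topological closure.
\<close>

lemma complete_sublattice_closure_of:
  assumes P: "sublattice X P"
  shows "complete_sublattice X (family_topology X closure_of P)"
proof -
  let ?C = "family_topology X closure_of P"
  have PX: "P \<subseteq> Pow (Pow X)" and "P \<noteq> {}"
    and PL: "\<And>x y. x \<in> P \<Longrightarrow> y \<in> P \<Longrightarrow> x \<union> y \<in> P \<and> x \<inter> y \<in> P"
    using P by (auto simp: sublattice_def)
  note iff = in_closure_of_family_iff[OF PX]
  have CX: "?C \<subseteq> Pow (Pow X)"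
    using closure_of_subset_topspace by (metis topspace_family_topology)
  have compl: "\<Union>S \<in> ?C \<and> \<Inter>S \<in> ?C" if S: "S \<subseteq> ?C" "S \<noteq> {}" for S
  proof -
    have SX: "S \<subseteq> Pow (Pow X)"
      using S(1) CX by (rule subset_trans)
    have tr: "(\<exists>y\<in>P. y \<inter> F = \<Union>S \<inter> F) \<and> (\<exists>y\<in>P. y \<inter> F = \<Inter>S \<inter> F)" if F: "finite F" for F
    proof -
      let ?T = "\<lambda>y. y \<inter> F"
      have "finite (?T ` S)"
        by (rule finite_subset[of _ "Pow F"]) (use F in auto)
      moreover have "?T ` S \<subseteq> ?T ` P"
      proof (rule image_subsetI)
        fix s assume "s \<in> S"
        then have "s \<in> ?C"
          using S(1) by (rule subsetD[rotated])
        then obtain y where "y \<in> P" "y \<inter> F = s \<inter> F"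
          using F unfolding iff by blast
        then show "?T s \<in> ?T ` P"
          by (metis image_eqI)
      qed
      moreover have "x \<union> y \<in> ?T ` P \<and> x \<inter> y \<in> ?T ` P" if xy: "x \<in> ?T ` P" "y \<in> ?T ` P" for x y
      proof -
        obtain a b where ab: "a \<in> P" "b \<in> P" "x = ?T a" "y = ?T b"
          using xy by blast
        then have "x \<union> y = ?T (a \<union> b)" "x \<inter> y = ?T (a \<inter> b)"
          by auto
        then show ?thesis
          using PL[OF ab(1,2)] by blast
      qed
      ultimately have "\<Union>(?T ` S) \<in> ?T ` P \<and> \<Inter>(?T ` S) \<in> ?T ` P"
        using S(2) by (intro Union_Inter_mem_if_finite) auto
      moreover have "\<Union>(?T ` S) = \<Union>S \<inter> F" "\<Inter>(?T ` S) = \<Inter>S \<inter> F"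
        using S(2) by auto
      ultimately have "\<Union>S \<inter> F \<in> ?T ` P" "\<Inter>S \<inter> F \<in> ?T ` P"
        by (simp_all only:)
      then show ?thesis
        by (elim imageE) metis
    qed
    have "\<Union>S \<in> Pow (Pow X)"
      by (intro PowI Union_least) (meson SX PowD subsetD)
    moreover have "\<Inter>S \<in> Pow (Pow X)"
    proof -
      obtain s where "s \<in> S"
        using S(2) by blast
      then show ?thesis
        using SX by (meson Inter_lower PowD PowI subsetD subset_trans)
    qed
    ultimately show ?thesis
      by (simp only: iff simp_thms) (meson tr)
  qed
  have "sublattice X ?C"
    unfolding sublattice_def
  proof (intro conjI ballI)
    show "?C \<noteq> {}"
      using \<open>P \<noteq> {}\<close> closure_of_subset[of P "family_topology X"] PX
      by (metis subset_empty topspace_family_topology)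
    fix x y assume "x \<in> ?C" "y \<in> ?C"
    then show "x \<union> y \<in> ?C" "x \<inter> y \<in> ?C"
      using compl[of "{x, y}"] by simp_all
  qed (rule CX)
  then show ?thesis
    unfolding complete_sublattice_def
  proof (intro conjI allI impI)
    fix S assume "S \<subseteq> ?C \<and> S \<noteq> {}"
    then show "\<Union>S \<in> ?C" "\<Inter>S \<in> ?C"
      using compl[of S] by simp_all
  qed
qed

lemma closure_of_subset_complete_sublattice:
  assumes L: "complete_sublattice X L" and PL: "P \<subseteq> L"
  shows "family_topology X closure_of P \<subseteq> L"
proof
  fix x assume x: "x \<in> family_topology X closure_of P"
  have LX: "L \<subseteq> Pow (Pow X)"
    and cl: "\<And>S. S \<subseteq> L \<Longrightarrow> S \<noteq> {} \<Longrightarrow> \<Union>S \<in> L \<and> \<Inter>S \<in> L"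
    using L by (auto simp: complete_sublattice_def sublattice_def)
  have PX: "P \<subseteq> Pow (Pow X)"
    using PL LX by blast
  let ?J = "insert P ((\<lambda>A. {y \<in> P. A \<notin> y}) ` (Pow X - x))"
  have "{y \<in> P. A \<notin> y} \<noteq> {}" if "A \<notin> x" for A
  proof -
    have "\<exists>y\<in>P. y \<inter> {A} = x \<inter> {A}"
      using x by (simp add: in_closure_of_family_iff[OF PX])
    then show ?thesis
      using that by blast
  qed
  moreover have "P \<noteq> {}"
    using x by auto
  ultimately have "\<Union>S \<in> L" if "S \<in> ?J" for S
    using that PL by (intro cl[THEN conjunct1]) auto
  then have "\<Inter>(Union ` ?J) \<in> L"
    by (intro cl[THEN conjunct2]) auto
  then show "x \<in> L"
    using closure_point_eq_Inter_Union[OF PX x] by simp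
qed

lemma closure_of_eq_lattice_completion:
  assumes "sublattice X P"
  shows "family_topology X closure_of P = lattice_completion X P"
proof
  show "family_topology X closure_of P \<subseteq> lattice_completion X P"
    unfolding lattice_completion_def using closure_of_subset_complete_sublattice by blast
  have "P \<subseteq> family_topology X closure_of P"
    using assms by (intro closure_of_subset) (simp add: sublattice_def)
  then show "lattice_completion X P \<subseteq> family_topology X closure_of P"
    unfolding lattice_completion_def using complete_sublattice_closure_of[OF assms] by blast
qed

section \<open>Limit points and completion of an infinite sublattice\<close>

theorem theorem3p3:
  fixes X :: "'a set" and P :: "'a set set set" and x :: "'a set set"
  assumes "infinite X"
    and "sublattice X P" and "infinite P"
    and "x \<in> Pow (Pow X)"
  shows "(x \<in> family_topology X derived_set_of P \<longrightarrow>
      (\<exists>(J :: 'a set set set set) (I :: 'a set set set \<Rightarrow> 'a set set set)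
         (xx :: 'a set set \<Rightarrow> 'a set set set \<Rightarrow> 'a set set).
        J \<noteq> {} \<and>
        x = (\<Inter>j\<in>J. \<Union>i\<in>I j. xx i j) \<and>
        (\<forall>j\<in>J. \<forall>i\<in>I j. x \<noteq> xx i j) \<and>
        (\<forall>j\<in>J. infinite {xx i j | i. i \<in> I j} \<and> {xx i j | i. i \<in> I j} \<subseteq> P)))
    \<and> family_topology X closure_of P = lattice_completion X P"
proof (intro conjI impI)
  assume x: "x \<in> family_topology X derived_set_of P"
  have "P \<subseteq> Pow (Pow X)"
    using assms(2) by (simp add: sublattice_def)
  from limit_point_eq_Inter_Union[OF this assms(3) x]
  obtain J where J: "J \<noteq> {}" "x = (\<Inter>S\<in>J. \<Union>S)" "\<And>S. S \<in> J \<Longrightarrow> infinite S \<and> S \<subseteq> P - {x}"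
    by blast
  \<comment> \<open>The sets \<open>S \<in> J\<close> and their members serve as their own indices.\<close>
  show "\<exists>(J :: 'a set set set set) (I :: 'a set set set \<Rightarrow> 'a set set set)
         (xx :: 'a set set \<Rightarrow> 'a set set set \<Rightarrow> 'a set set).
        J \<noteq> {} \<and>
        x = (\<Inter>j\<in>J. \<Union>i\<in>I j. xx i j) \<and>
        (\<forall>j\<in>J. \<forall>i\<in>I j. x \<noteq> xx i j) \<and>
        (\<forall>j\<in>J. infinite {xx i j | i. i \<in> I j} \<and> {xx i j | i. i \<in> I j} \<subseteq> P)"
  proof (intro exI conjI)
    show "J \<noteq> {}"
      by (rule J(1))
    show "x = (\<Inter>j\<in>J. \<Union>i\<in>id j. (\<lambda>i _. i) i j)"
      using J(2) by simp
    show "\<forall>j\<in>J. \<forall>i\<in>id j. x \<noteq> (\<lambda>i _. i) i j"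
      using J(3) by auto
    show "\<forall>j\<in>J. infinite {(\<lambda>i _. i) i j | i. i \<in> id j} \<and> {(\<lambda>i _. i) i j | i. i \<in> id j} \<subseteq> P"
      using J(3) by auto
  qed
qed (rule closure_of_eq_lattice_completion[OF assms(2)])

end
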